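(* Let $d,m\ge 1$ be integers, let $\mathbf{A}=(a_{ij})$ be an $m\times d$ matrix with entries in $\mathbb{N}$, let $X_1,\dots,X_d$ be $\mathbb{N}$-valued random variables on a common probability space (not necessarily independent), and define random variables $Y_1,\dots,Y_m$ by $(Y_1,\dots,Y_m)^T=\mathbf{A}(X_1,\dots,X_d)^T$. Let $(k_1,\dots,k_m)\in\mathbb{N}^m$ with $\mathbb{P}(Y_1=k_1,\dots,Y_m=k_m)>0$, and let $(s_1,\dots,s_d)\in\mathbb{N}^d$. Then the conditional factorial moments of $(X_1,\dots,X_d)$ given that $Y_1=k_1,\dots,Y_m=k_m$ are $$\mathbb{E}\bigl(X_1^{(s_1)}\cdots X_d^{(s_d)}\mid Y_1=k_1,\dots,Y_m=k_m\bigr)=\frac{[z_1^{k_1}\cdots z_m^{k_m}]\left(\frac{\partial^{s_1}}{\partial t_1^{s_1}}\cdots\frac{\partial^{s_d}}{\partial t_d^{s_d}}G_{\mathbf{X}}\Bigl(t_1\prod_{i=1}^m z_i^{a_{i1}},\dots,t_d\prod_{i=1}^m z_i^{a_{id}}\Bigr)\right)\Big|_{t_1=\cdots=t_d=1}}{[z_1^{k_1}\cdots z_m^{k_m}]\,G_{\mathbf{X}}\Bigl(\prod_{i=1}^m z_i^{a_{i1}},\dots,\prod_{i=1}^m z_i^{a_{id}}\Bigr)}.$$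
   Context: $\mathbb{N}=\mathbb{Z}_{\ge 0}$. The multivariate probability generating function of $X_1,\dots,X_d$ is $G_{\mathbf{X}}(t_1,\dots,t_d)=\sum_{(j_1,\dots,j_d)\in\mathbb{N}^d}\mathbb{P}(X_1=j_1,\dots,X_d=j_d)\,t_1^{j_1}\cdots t_d^{j_d}$. The notation $X^{(s)}$ denotes the falling factorial $X^{(s)}=\frac{X!}{(X-s)!}=X(X-1)\cdots(X-s+1)$, which is $0$ when $X<s$ and $1$ when $s=0$. $[z_1^{k_1}\cdots z_m^{k_m}]G$ denotes the coefficient of $z_1^{k_1}\cdots z_m^{k_m}$ in the formal power series $G$. Series are formal: monomials are substituted term by term and like powers of the $z_i$ collected, and the partial derivatives in the $t_r$ are taken termwise. Evaluation at $t_1=\cdots=t_d=1$ means summing the resulting nonnegative coefficients for each monomial in the $z_i$, with values in $[0,\infty]$ (the conditional expectation, of a nonnegative random variable, is likewise understood in $[0,\infty]$). *)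

theory Defs
  imports "HOL-Probability.Probability"
begin

text \<open>
  Formal power series in a finite set of variables \<open>'v\<close> with coefficients in \<open>[0,\<infinity>]\<close>: a series is its
  family of coefficients, so \<open>F n\<close> is the coefficient of the monomial with exponents \<open>n\<close>.
  Every family in \<^typ>\<open>ennreal\<close> is summable, so the infinite sums below are the usual ones, and the
  order of summation is irrelevant.
\<close>

type_synonym 'v monom_exp = "'v \<Rightarrow> nat"
type_synonym 'v nnseries = "'v monom_exp \<Rightarrow> ennreal"

text \<open>Termwise derivative in one variable: \<open>c x^(n+1)\<close> contributes \<open>(n+1) c x^n\<close>.\<close>

definition partial_deriv :: "'v \<Rightarrow> 'v nnseries \<Rightarrow> 'v nnseries" where
  "partial_deriv v F = (\<lambda>n. of_nat (Suc (n v)) * F (n(v := Suc (n v))))"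

text \<open>
  \<open>monom_subst e F\<close> replaces the variable \<open>x\<^sub>r\<close> of \<open>F\<close> by the monomial with exponents \<open>e r\<close>, for every
  \<open>r\<close>. The monomial of \<open>F\<close> with exponents \<open>j\<close> then has exponents \<open>\<Sum>r. j r * e r\<close>, and like monomials
  are collected.
\<close>

definition monom_subst ::
    "('d::finite \<Rightarrow> 'v monom_exp) \<Rightarrow> 'd nnseries \<Rightarrow> 'v nnseries" where
  "monom_subst e F =
     (\<lambda>n. \<Sum>\<^sub>\<infinity>j\<in>{j. (\<lambda>v. \<Sum>r\<in>UNIV. j r * e r v) = n}. F j)"

text \<open>
  In a series in two groups of variables \<open>t\<close> (tagged \<^const>\<open>Inl\<close>) and \<open>z\<close> (tagged \<^const>\<open>Inr\<close>):
  the mixed derivative of orders \<open>s\<close> in the variables \<open>t\<close>, and the evaluation at \<open>t = 1\<close>.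
  The fold composes the iterated derivatives over all \<open>t\<close>; they commute, as shown below,
  so the order of composition does not matter.
\<close>

definition mixed_deriv ::
    "('d::finite \<Rightarrow> nat) \<Rightarrow> ('d + 'm) nnseries \<Rightarrow> ('d + 'm) nnseries" where
  "mixed_deriv s F = Finite_Set.fold (\<lambda>r. partial_deriv (Inl r) ^^ s r) F UNIV"

definition eval_at_one :: "('d + 'm) nnseries \<Rightarrow> 'm nnseries" where
  "eval_at_one F = (\<lambda>k. \<Sum>\<^sub>\<infinity>j\<in>UNIV. F (case_sum j k))"

definition joint_pgf :: "'a measure \<Rightarrow> ('d \<Rightarrow> 'a \<Rightarrow> nat) \<Rightarrow> 'd nnseries" where
  "joint_pgf M X = (\<lambda>j. emeasure M {\<omega> \<in> space M. \<forall>r. X r \<omega> = j r})"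

text \<open>
  Exponents of \<open>\<Prod>i. z\<^sub>i ^ a\<^sub>i\<^sub>r\<close> as a monomial in \<open>z\<close>, and of \<open>t\<^sub>r * (\<Prod>i. z\<^sub>i ^ a\<^sub>i\<^sub>r)\<close> as a monomial
  in \<open>t\<close> and \<open>z\<close>.
\<close>

definition z_monom :: "nat ^ 'd ^ 'm \<Rightarrow> 'd \<Rightarrow> 'm monom_exp" where
  "z_monom A r = (\<lambda>i. A $ i $ r)"

definition tz_monom :: "nat ^ 'd ^ 'm \<Rightarrow> 'd \<Rightarrow> ('d + 'm) monom_exp" where
  "tz_monom A r = case_sum (\<lambda>r'. of_bool (r' = r)) (z_monom A r)"

text \<open>If \<open>x < s\<close>, the factor for \<open>i = x\<close> is \<open>0\<close>, so truncated subtraction does no harm.\<close>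

definition falling_factorial :: "nat \<Rightarrow> nat \<Rightarrow> nat" where
  "falling_factorial x s = (\<Prod>i<s. x - i)"

definition cond_expectation_event :: "'a measure \<Rightarrow> ('a \<Rightarrow> ennreal) \<Rightarrow> 'a set \<Rightarrow> ennreal" where
  "cond_expectation_event M Z B = (\<integral>\<^sup>+\<omega>. Z \<omega> \<partial>uniform_measure M B)"

lemma falling_factorial_eq_0: "x < s \<Longrightarrow> falling_factorial x s = 0"
  by (auto simp: falling_factorial_def)

lemma falling_factorial_eq_fact:
  assumes "s \<le> x"
  shows "falling_factorial x s = fact x div fact (x - s)"
proof -
  have "falling_factorial x s * fact (x - s) = fact x"
    using assms
  proof (induction s)
    case 0
    then show ?case by (simp add: falling_factorial_def)
  next
    case (Suc s)
    then have "fact (x - s) = (x - s) * fact (x - Suc s)"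
      by (metis Suc_diff_Suc Suc_le_lessD diff_Suc_Suc fact_Suc of_nat_id)
    with Suc show ?case
      by (simp add: falling_factorial_def mult_ac)
  qed
  then show ?thesis
    by (metis fact_nonzero nonzero_mult_div_cancel_right)
qed

lemma partial_deriv_commute:
  "partial_deriv v (partial_deriv w F) = partial_deriv w (partial_deriv v F)"
  by (cases "v = w") (auto simp: partial_deriv_def fun_upd_twist mult_ac)

lemma comp_fun_commute_partial_deriv:
  "comp_fun_commute (\<lambda>r. partial_deriv (Inl r) ^^ s r)"
proof -
  interpret comp_fun_commute "\<lambda>r. partial_deriv (Inl r)"
    by unfold_locales (simp add: fun_eq_iff partial_deriv_commute)
  show ?thesis by (rule comp_fun_commute_funpow)
qed

end

theory Submission
  imports Defs
begin

text \<open>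
  Numerator and denominator are expectations over the event \<open>B = {Y = k}\<close>, written as sums over the
  values \<open>j\<close> of the random vector \<open>X\<close> that solve \<open>A j = k\<close>.

  In the doubly indexed series, the substitution \<open>t\<^sub>r * (\<Prod>i. z\<^sub>i ^ a\<^sub>i\<^sub>r)\<close> sends distinct monomials
  \<open>j\<close> to distinct monomials, because the \<open>t\<close>-exponents record \<open>j\<close> itself; so no terms are collected
  and the coefficient at \<open>t ^ j * z ^ k\<close> is the probability of \<open>X = j\<close> if \<open>A j = k\<close>, and \<open>0\<close> otherwise
  (\<open>tz_subst_coeff\<close>). Differentiating \<open>s\<^sub>r\<close> times in every \<open>t\<^sub>r\<close> moves the coefficient of \<open>t ^ (j + s)\<close>
  to \<open>t ^ j\<close> and multiplies it by the product of the falling factorials of \<open>j + s\<close>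
  (\<open>mixed_deriv_coeff\<close>). Setting \<open>t = 1\<close> sums over \<open>j\<close>; since falling factorials vanish at arguments
  below their order, the shift by \<open>s\<close> may be undone, which gives the sum over all solutions of
  \<open>A j = k\<close> of the factorial product times the probability of \<open>X = j\<close> (\<open>eval_mixed_deriv_coeff\<close>).

  Expanding an expectation over the countably many values of \<open>X\<close>
  (\<open>nn_integral_countable_valued\<close>) identifies this sum with the integral of the factorial product
  over \<open>B\<close>. The same expansion with the constant integrand \<open>1\<close> identifies the denominator with the
  probability of \<open>B\<close>.
\<close>

section \<open>Sums and expectations with values in the extended nonnegative reals\<close>

text \<open>
  Enumerating an infinite index set turns both sides into the same series over the natural numbers.
\<close>

lemma infsum_ennreal_eq_nn_integral:
  fixes f :: "'b \<Rightarrow> ennreal"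
  assumes "countable I"
  shows "infsum f I = (\<integral>\<^sup>+j. f j \<partial>count_space I)"
proof (cases "finite I")
  case True
  then show ?thesis by (simp add: nn_integral_count_space_finite)
next
  case False
  have bij: "bij_betw (from_nat_into I) UNIV I"
    using assms False by (rule bij_betw_from_nat_into)
  have "infsum f I = (\<Sum>\<^sub>\<infinity>n. f (from_nat_into I n))"
    by (rule infsum_reindex_bij_betw[OF bij, symmetric])
  also have "\<dots> = (\<Sum>n. f (from_nat_into I n))"
    by (intro sums_unique has_sum_imp_sums has_sum_infsum nonneg_summable_on_complete) simp
  also have "\<dots> = (\<integral>\<^sup>+n. f (from_nat_into I n) \<partial>count_space UNIV)"
    by (rule nn_integral_count_space_nat[symmetric])
  also have "\<dots> = (\<integral>\<^sup>+j. f j \<partial>count_space I)"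
    by (rule nn_integral_bij_count_space[OF bij])
  finally show ?thesis .
qed

lemma nn_integral_countable_valued:
  fixes X :: "'a \<Rightarrow> 'b::countable" and g :: "'b \<Rightarrow> ennreal"
  assumes [measurable]: "X \<in> measurable M (count_space UNIV)"
  shows "(\<integral>\<^sup>+\<omega>. g (X \<omega>) \<partial>M) = (\<Sum>\<^sub>\<infinity>j. g j * emeasure M {\<omega> \<in> space M. X \<omega> = j})"
proof -
  let ?E = "\<lambda>j. {\<omega> \<in> space M. X \<omega> = j}"
  have "(\<integral>\<^sup>+\<omega>. g (X \<omega>) \<partial>M) = (\<integral>\<^sup>+\<omega>. (\<integral>\<^sup>+j. g j * indicator (?E j) \<omega> \<partial>count_space UNIV) \<partial>M)"
  proof (rule nn_integral_cong)
    fix \<omega> assume "\<omega> \<in> space M"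
    then have "(\<integral>\<^sup>+j. g j * indicator (?E j) \<omega> \<partial>count_space UNIV) = (\<Sum>j\<in>{X \<omega>}. g j * indicator (?E j) \<omega>)"
      by (intro nn_integral_count_space') (auto simp: indicator_def)
    with \<open>\<omega> \<in> space M\<close> show "g (X \<omega>) = (\<integral>\<^sup>+j. g j * indicator (?E j) \<omega> \<partial>count_space UNIV)"
      by simp
  qed
  also have "\<dots> = (\<integral>\<^sup>+j. (\<integral>\<^sup>+\<omega>. g j * indicator (?E j) \<omega> \<partial>M) \<partial>count_space UNIV)"
    by (rule nn_integral_count_space_nn_integral) auto
  also have "\<dots> = (\<integral>\<^sup>+j. g j * emeasure M (?E j) \<partial>count_space UNIV)"
    by (intro nn_integral_cong nn_integral_cmult_indicator) measurable
  also have "\<dots> = (\<Sum>\<^sub>\<infinity>j. g j * emeasure M (?E j))"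
    by (rule infsum_ennreal_eq_nn_integral[symmetric]) simp
  finally show ?thesis .
qed

lemma measurable_finite_family:
  fixes X :: "'d::finite \<Rightarrow> 'a \<Rightarrow> nat"
  assumes [measurable]: "\<And>r. X r \<in> measurable M (count_space UNIV)"
  shows "(\<lambda>\<omega> r. X r \<omega>) \<in> measurable M (count_space UNIV)"
proof -
  have "(\<lambda>\<omega> r. X r \<omega>) -` {j} \<inter> space M \<in> sets M" for j
  proof -
    have "(\<lambda>\<omega> r. X r \<omega>) -` {j} \<inter> space M = {\<omega> \<in> space M. \<forall>r. X r \<omega> = j r}"
      by (auto simp: fun_eq_iff)
    also have "\<dots> \<in> sets M"
      by measurable
    finally show ?thesis .
  qed
  then show ?thesis
    by (subst measurable_count_space_eq2_countable) auto
qed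

text \<open>
  The expectation of a function of \<open>X\<close> over an event \<open>X \<in> S\<close>, in terms of the coefficients of the
  generating function. It serves for the numerator, and with \<open>g = 1\<close> for the denominator.
\<close>

lemma nn_integral_joint_pgf:
  fixes X :: "'d::finite \<Rightarrow> 'a \<Rightarrow> nat" and g :: "('d \<Rightarrow> nat) \<Rightarrow> ennreal"
  assumes "\<And>r. X r \<in> measurable M (count_space UNIV)"
  shows "(\<integral>\<^sup>+\<omega>. g (\<lambda>r. X r \<omega>) * indicator {\<omega> \<in> space M. (\<lambda>r. X r \<omega>) \<in> S} \<omega> \<partial>M)
    = (\<Sum>\<^sub>\<infinity>j\<in>S. g j * joint_pgf M X j)"
proof -
  have "(\<integral>\<^sup>+\<omega>. g (\<lambda>r. X r \<omega>) * indicator {\<omega> \<in> space M. (\<lambda>r. X r \<omega>) \<in> S} \<omega> \<partial>M)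
      = (\<integral>\<^sup>+\<omega>. g (\<lambda>r. X r \<omega>) * indicator S (\<lambda>r. X r \<omega>) \<partial>M)"
    by (rule nn_integral_cong) (auto simp: indicator_def)
  also have "\<dots> = (\<Sum>\<^sub>\<infinity>j. g j * indicator S j * joint_pgf M X j)"
    using nn_integral_countable_valued[OF measurable_finite_family[of X M, OF assms],
        of "\<lambda>j. g j * indicator S j"]
    by (simp add: joint_pgf_def fun_eq_iff)
  also have "\<dots> = (\<Sum>\<^sub>\<infinity>j\<in>S. g j * joint_pgf M X j)"
    by (rule infsum_cong_neutral) auto
  finally show ?thesis .
qed

section \<open>Coefficients of derivatives and substitutions\<close>

lemma partial_deriv_funpow_coeff:
  "(partial_deriv v ^^ q) F n
    = of_nat (falling_factorial (n v + q) q) * F (n(v := n v + q))"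
proof (induction q arbitrary: n)
  case 0
  then show ?case by (simp add: falling_factorial_def)
next
  case (Suc q)
  have "falling_factorial (n v + Suc q) (Suc q) = Suc (n v) * falling_factorial (n v + Suc q) q"
    by (simp add: falling_factorial_def)
  moreover have "(partial_deriv v ^^ Suc q) F n
      = of_nat (Suc (n v)) * (of_nat (falling_factorial (n v + Suc q) q) * F (n(v := n v + Suc q)))"
    unfolding funpow.simps o_apply partial_deriv_def[of v "(partial_deriv v ^^ q) F"] Suc.IH
    by simp
  ultimately show ?case
    by (simp only: of_nat_mult mult.assoc)
qed

text \<open>
  Stated for a fold over an arbitrary set of variables, so that one variable can be added at a time:
  the exponents of the variables already treated are shifted, the others are still in place.
\<close>

lemma fold_partial_deriv_coeff:
  fixes n :: "('d::finite + 'm) \<Rightarrow> nat"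
  shows "Finite_Set.fold (\<lambda>r. partial_deriv (Inl r) ^^ s r) F R n
    = of_nat (\<Prod>r\<in>R. falling_factorial (n (Inl r) + s r) (s r))
      * F (case_sum (\<lambda>r. if r \<in> R then n (Inl r) + s r else n (Inl r)) (\<lambda>i. n (Inr i)))"
proof -
  interpret comp_fun_commute "\<lambda>r. partial_deriv (Inl r :: 'd + 'm) ^^ s r"
    by (rule comp_fun_commute_partial_deriv)
  have "finite R" by simp
  then show ?thesis
  proof (induction R arbitrary: n)
    case empty
    have "case_sum (\<lambda>r. n (Inl r)) (\<lambda>i. n (Inr i)) = n"
      by (auto simp: fun_eq_iff split: sum.split)
    then show ?case
      by (simp only: Finite_Set.fold_empty prod.empty of_nat_1 mult_1_left empty_iff if_False)
  next
    case (insert q R)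
    let ?n = "n(Inl q := n (Inl q) + s q)"
    have factors: "(\<Prod>r\<in>R. falling_factorial (?n (Inl r) + s r) (s r))
        = (\<Prod>r\<in>R. falling_factorial (n (Inl r) + s r) (s r))"
      using insert.hyps by (intro prod.cong) auto
    have exponents: "case_sum (\<lambda>r. if r \<in> R then ?n (Inl r) + s r else ?n (Inl r)) (\<lambda>i. ?n (Inr i))
        = case_sum (\<lambda>r. if r \<in> insert q R then n (Inl r) + s r else n (Inl r)) (\<lambda>i. n (Inr i))"
      using insert.hyps by (auto simp: fun_eq_iff split: sum.split)
    let ?fold = "Finite_Set.fold (\<lambda>r. partial_deriv (Inl r) ^^ s r) F"
    have "?fold (insert q R) = (partial_deriv (Inl q) ^^ s q) (?fold R)"
      using insert.hyps by (rule fold_insert)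
    then have "?fold (insert q R) n
        = of_nat (falling_factorial (n (Inl q) + s q) (s q)) * ?fold R ?n"
      by (simp only: partial_deriv_funpow_coeff)
    then show ?case
      unfolding insert.IH factors exponents prod.insert[OF insert.hyps] of_nat_mult mult.assoc .
  qed
qed

lemma mixed_deriv_coeff:
  "mixed_deriv s F (case_sum j k)
    = of_nat (\<Prod>r\<in>UNIV. falling_factorial (j r + s r) (s r)) * F (case_sum (\<lambda>r. j r + s r) k)"
  by (simp add: mixed_deriv_def fold_partial_deriv_coeff)

text \<open>
  The exponents of the \<open>t\<close>-variables determine which monomial of \<open>P\<close> a term comes from, so the
  collecting sum has at most one term.
\<close>

lemma tz_subst_coeff:
  fixes A :: "nat ^ 'd ^ 'm"
  shows "monom_subst (tz_monom A) P (case_sum j k)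
    = (if (\<lambda>i. \<Sum>r\<in>UNIV. j r * z_monom A r i) = k then P j else 0)"
proof -
  have "(\<Sum>r\<in>UNIV. i r * tz_monom A r (Inl q)) = i q" for i q
    by (simp add: tz_monom_def of_bool_def if_distrib cong: if_cong)
  moreover have "(\<Sum>r\<in>UNIV. i r * tz_monom A r (Inr q)) = (\<Sum>r\<in>UNIV. i r * z_monom A r q)" for i q
    by (simp add: tz_monom_def)
  ultimately have "(\<lambda>v. \<Sum>r\<in>UNIV. i r * tz_monom A r v) = case_sum j k
      \<longleftrightarrow> i = j \<and> (\<lambda>i. \<Sum>r\<in>UNIV. j r * z_monom A r i) = k" for i
    by (auto simp: fun_eq_iff split_sum_all)
  then show ?thesis
    by (simp add: monom_subst_def)
qed

text \<open>
  After evaluation at \<open>t = 1\<close> the sum runs over the shifted exponents \<open>j + s\<close>. Summing over all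
  exponents instead adds only terms with \<open>j r < s r\<close> for some \<open>r\<close>, whose falling factorial is \<open>0\<close>.
\<close>

lemma eval_mixed_deriv_coeff:
  fixes A :: "nat ^ 'd ^ 'm"
  shows "eval_at_one (mixed_deriv s (monom_subst (tz_monom A) P)) k
    = (\<Sum>\<^sub>\<infinity>j\<in>{j. (\<lambda>i. \<Sum>r\<in>UNIV. j r * z_monom A r i) = k}.
        of_nat (\<Prod>r\<in>UNIV. falling_factorial (j r) (s r)) * P j)"
proof -
  let ?S = "{j. (\<lambda>i. \<Sum>r\<in>UNIV. j r * z_monom A r i) = k}"
  let ?f = "\<lambda>j. of_nat (\<Prod>r\<in>UNIV. falling_factorial (j r) (s r)) * (if j \<in> ?S then P j else 0) :: ennreal"
  let ?shift = "\<lambda>j r. j r + s r"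
  have inj: "inj ?shift"
    by (auto simp: inj_def fun_eq_iff)
  have vanish: "\<exists>r. falling_factorial (j r) (s r) = 0" if "j \<notin> range ?shift" for j
  proof -
    have "\<exists>r. j r < s r"
    proof (rule ccontr)
      assume "\<nexists>r. j r < s r"
      then have "j = ?shift (\<lambda>r. j r - s r)"
        by (auto simp: fun_eq_iff not_less)
      then have "j \<in> range ?shift"
        by (rule range_eqI[of j ?shift "\<lambda>r. j r - s r"])
      with that show False ..
    qed
    then show ?thesis
      by (blast intro: falling_factorial_eq_0)
  qed
  have "eval_at_one (mixed_deriv s (monom_subst (tz_monom A) P)) k = (\<Sum>\<^sub>\<infinity>j. ?f (?shift j))"
    by (simp add: eval_at_one_def mixed_deriv_coeff tz_subst_coeff)
  also have "\<dots> = infsum ?f (range ?shift)"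
    using infsum_reindex[OF inj, of ?f] by (simp add: o_def)
  also have "\<dots> = (\<Sum>\<^sub>\<infinity>j\<in>?S. of_nat (\<Prod>r\<in>UNIV. falling_factorial (j r) (s r)) * P j)"
    by (rule infsum_cong_neutral) (auto dest: vanish)
  finally show ?thesis .
qed

section \<open>Conditional factorial moments\<close>

theorem theorem2:
  fixes M :: "'a measure"
    and A :: "nat ^ 'd ^ 'm"
    and X :: "'d \<Rightarrow> 'a \<Rightarrow> nat"
    and Y :: "'m \<Rightarrow> 'a \<Rightarrow> nat"
    and k :: "'m \<Rightarrow> nat"
    and s :: "'d \<Rightarrow> nat"
  assumes "prob_space M"
    and "\<And>r. X r \<in> measurable M (count_space UNIV)"
    and "\<And>\<omega>. \<omega> \<in> space M \<Longrightarrow> (\<chi> i. Y i \<omega>) = A *v (\<chi> r. X r \<omega>)"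
    and "measure M {\<omega> \<in> space M. \<forall>i. Y i \<omega> = k i} > 0"
  shows "cond_expectation_event M
           (\<lambda>\<omega>. of_nat (\<Prod>r\<in>UNIV. falling_factorial (X r \<omega>) (s r)))
           {\<omega> \<in> space M. \<forall>i. Y i \<omega> = k i}
         = eval_at_one (mixed_deriv s (monom_subst (tz_monom A) (joint_pgf M X))) k
           / monom_subst (z_monom A) (joint_pgf M X) k"
proof -
  let ?S = "{j. (\<lambda>i. \<Sum>r\<in>UNIV. j r * z_monom A r i) = k}"
  let ?B = "{\<omega> \<in> space M. (\<lambda>r. X r \<omega>) \<in> ?S}"
  let ?ff = "\<lambda>j. of_nat (\<Prod>r\<in>UNIV. falling_factorial (j r) (s r)) :: ennreal"
  have X_meas: "(\<lambda>\<omega> r. X r \<omega>) \<in> measurable M (count_space UNIV)"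
    using assms(2) by (rule measurable_finite_family)
  have B_sets: "?B \<in> sets M"
    by (rule measurable_sets_Collect[of "\<lambda>\<omega> r. X r \<omega>" M "count_space UNIV", OF X_meas]) simp
  have ff_meas: "(\<lambda>\<omega>. ?ff (\<lambda>r. X r \<omega>)) \<in> borel_measurable M"
    by (rule measurable_compose[of "\<lambda>\<omega> r. X r \<omega>" M "count_space UNIV" ?ff, OF X_meas]) simp
  have "Y i \<omega> = (\<Sum>r\<in>UNIV. X r \<omega> * z_monom A r i)" if "\<omega> \<in> space M" for i \<omega>
    using assms(3)[OF that] by (simp add: vec_eq_iff matrix_vector_mult_def z_monom_def mult.commute)
  then have event: "{\<omega> \<in> space M. \<forall>i. Y i \<omega> = k i} = ?B"
    by (auto simp: fun_eq_iff)
  have denominator: "emeasure M ?B = monom_subst (z_monom A) (joint_pgf M X) k"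
    using nn_integral_joint_pgf[of X M "\<lambda>_. 1" ?S, OF assms(2)] B_sets
    by (simp add: monom_subst_def)
  have "cond_expectation_event M (\<lambda>\<omega>. ?ff (\<lambda>r. X r \<omega>)) ?B
      = (\<integral>\<^sup>+\<omega>. ?ff (\<lambda>r. X r \<omega>) * indicator ?B \<omega> \<partial>M) / emeasure M ?B"
    unfolding cond_expectation_event_def
    by (rule nn_integral_uniform_measure[OF ff_meas B_sets])
  also have "\<dots> = eval_at_one (mixed_deriv s (monom_subst (tz_monom A) (joint_pgf M X))) k
      / monom_subst (z_monom A) (joint_pgf M X) k"
    unfolding denominator eval_mixed_deriv_coeff
    using nn_integral_joint_pgf[of X M ?ff ?S, OF assms(2)] by (simp only:)
  finally show ?thesis
    unfolding event .
qed

end
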